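(* Let $X$ and $Y$ be random elements taking values in measurable spaces $\Omega_X,\Omega_Y$. Let $\mathcal H_X$ and $\mathcal H_Y$ be Hilbert spaces of real functions on $\Omega_X$ and $\Omega_Y$ satisfying: (A) $\mathcal H_X$ and $\mathcal H_Y$ are dense subsets of $L_2(P_X)$ and $L_2(P_Y)$ modulo constants; (B) there are constants $C_1,C_2>0$ such that $\operatorname{var}[f(X)]\le C_1\|f\|_{\mathcal H_X}^2$ for all $f\in\mathcal H_X$ and $\operatorname{var}[g(Y)]\le C_2\|g\|_{\mathcal H_Y}^2$ for all $g\in\mathcal H_Y$. Let $S=E(V-V_{X|Y})^2:L_2(P_X)\to L_2(P_X)$, where $V_{X|Y}$ is the heteroscedastic conditional variance operator given $Y$ and $V$ is the unconditional covariance operator, and let $\mathfrak C_{Y|X}=L_2(P_X)\ominus[L_2(P_X)\ominus L_2(P_Y)]$ be the regression class. Then $$\mathfrak C_{Y|X}\subseteq\overline{\operatorname{ran}}\,S.$$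
   Context: $X,Y$ are defined on a probability space $(\Omega,\mathcal F,P)$ and take values in measurable spaces $(\Omega_X,\mathcal F_X)$, $(\Omega_Y,\mathcal F_Y)$, with distributions $P_X,P_Y,P_{XY}$ dominated by $\sigma$-finite measures; regular conditional distributions of $X$ given $Y=y$ are assumed to exist. $L_2(P_X)$, $L_2(P_Y)$, $L_2(P_{XY})$ denote spaces of mean-zero square-integrable real functions, the first two viewed as closed subspaces of the third. For subspaces $\mathcal S_1,\mathcal S_2$ of a Hilbert space, $\mathcal S_1\ominus\mathcal S_2=\mathcal S_1\cap\mathcal S_2^\perp$. Density modulo constants: $A\subseteq B$ modulo constants if for each $f\in A$ there is $c\in\mathbb R$ with $f+c\in B$; $A$ is a dense subset of $B$ modulo constants if $A\subseteq B$ modulo constants and for each $f\in B$ there are $f_n\in A$ and $c_n\in\mathbb R$ with $f_n+c_n\in B$ and $f_n+c_n\to f$ in the topology of $B$. Heteroscedastic conditional variance operator: let $E'_{X|Y}f$ denote the function $y\mapsto E[f(X)|Y=y]$ (for noncentered square-integrable $f$ it is characterized by $\langle g,E'_{X|Y}f\rangle=E(g(Y)f(X))$ for all square-integrable $g$ of $Y$, the inner product being the noncentered $L_2$ inner product for $P_Y$). For each $y\in\Omega_Y$, $V_{X|Y}(y)\in\mathcal B(L_2(P_X))$ is the operator representing the bilinear form $$(f,g)\mapsto\bigl(E'_{X|Y}(fg)-E'_{X|Y}f\,E'_{X|Y}g\bigr)(y)=\operatorname{cov}[f(X),g(X)\mid Y=y]$$ on $L_2(P_X)\times L_2(P_X)$,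 i.e. $\langle f,V_{X|Y}(y)g\rangle_{L_2(P_X)}$ equals this form; it is presupposed that this form is well defined and bounded. $V:L_2(P_X)\to L_2(P_X)$ is defined by $\langle f,Vg\rangle_{L_2(P_X)}=\operatorname{cov}(f(X),g(X))$. Expectation of a random operator: for $A:\Omega_Y\to\mathcal B(L_2(P_X))$, $E(A)$ is the nonrandom operator $f\mapsto\tilde f$ on $L_2(P_X)$ with $\tilde f(x)=\int_{\Omega_Y}(A(y)f)(x)\,P_Y(dy)$; it is presupposed, for $A(y)=(V-V_{X|Y}(y))^2$, that this defines a bounded operator on $L_2(P_X)$ satisfying $\langle g,E(A)f\rangle_{L_2(P_X)}=\int_{\Omega_Y}\langle g,A(y)f\rangle_{L_2(P_X)}P_Y(dy)$. $\overline{\operatorname{ran}}$ denotes the closure of the range. *)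

theory Defs
  imports "HOL-Probability.Probability"
begin

text \<open>
  Elements of the \<open>L\<^sub>2\<close> spaces are represented by functions; two functions that agree almost
  everywhere stand for the same element. Accordingly \<open>l2_norm\<close> is a seminorm on
  representatives, identities between elements hold almost everywhere, and operators act on
  representatives.
\<close>

definition L2_centered :: "'a measure \<Rightarrow> ('a \<Rightarrow> real) set" where
  "L2_centered N =
     {f \<in> borel_measurable N. integrable N (\<lambda>x. (f x)\<^sup>2) \<and> (\<integral>x. f x \<partial>N) = 0}"

definition l2_inner :: "'a measure \<Rightarrow> ('a \<Rightarrow> real) \<Rightarrow> ('a \<Rightarrow> real) \<Rightarrow> real" where
  "l2_inner N f g = (\<integral>x. f x * g x \<partial>N)"

definition l2_norm :: "'a measure \<Rightarrow> ('a \<Rightarrow> real) \<Rightarrow> real" where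
  "l2_norm N f = sqrt (l2_inner N f f)"

definition l2_closure :: "'a measure \<Rightarrow> ('a \<Rightarrow> real) set \<Rightarrow> ('a \<Rightarrow> real) set" where
  "l2_closure N A =
     {f \<in> L2_centered N. \<forall>e>0. \<exists>g\<in>A. l2_norm N (\<lambda>x. g x - f x) < e}"

definition ortho_diff ::
    "'a measure \<Rightarrow> ('a \<Rightarrow> real) set \<Rightarrow> ('a \<Rightarrow> real) set \<Rightarrow> ('a \<Rightarrow> real) set" where
  "ortho_diff N S1 S2 = {f \<in> S1. \<forall>g\<in>S2. l2_inner N f g = 0}"

text \<open>
  A Hilbert space of real functions on \<open>\<Omega>\<close> is given by an abstract Hilbert space \<open>'h\<close>
  together with evaluation: \<open>evf h\<close> is the function that \<open>h\<close> denotes. Linearity says that the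
  vector space operations are the pointwise ones, and injectivity that \<open>h\<close> is determined by its
  values on \<open>\<Omega>\<close>. Evaluation at a point need not be continuous. The set of functions in the
  space is \<open>range evf\<close>.
\<close>

definition function_hilbert_space ::
    "'a set \<Rightarrow> ('h::{real_inner, complete_space} \<Rightarrow> 'a \<Rightarrow> real) \<Rightarrow> bool" where
  "function_hilbert_space \<Omega> evf \<longleftrightarrow>
     (\<forall>x\<in>\<Omega>. linear (\<lambda>h. evf h x)) \<and>
     (\<forall>h h'. (\<forall>x\<in>\<Omega>. evf h x = evf h' x) \<longrightarrow> h = h')"

definition subset_mod_const :: "('a \<Rightarrow> real) set \<Rightarrow> ('a \<Rightarrow> real) set \<Rightarrow> bool" where
  "subset_mod_const A B \<longleftrightarrow> (\<forall>f\<in>A. \<exists>c. (\<lambda>x. f x + c) \<in> B)"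

definition dense_mod_const ::
    "'a measure \<Rightarrow> ('a \<Rightarrow> real) set \<Rightarrow> ('a \<Rightarrow> real) set \<Rightarrow> bool" where
  "dense_mod_const N A B \<longleftrightarrow>
     subset_mod_const A B \<and>
     (\<forall>f\<in>B. \<exists>F c. (\<forall>n::nat. F n \<in> A \<and> (\<lambda>x. F n x + c n) \<in> B) \<and>
        (\<lambda>n. l2_norm N (\<lambda>x. F n x + c n - f x)) \<longlonglongrightarrow> 0)"

text \<open>
  Boundedness and linearity make an operator on representatives respect almost everywhere
  equality, so it induces an operator on classes.
\<close>

definition bounded_op :: "'a measure \<Rightarrow> (('a \<Rightarrow> real) \<Rightarrow> ('a \<Rightarrow> real)) \<Rightarrow> bool" where
  "bounded_op N T \<longleftrightarrow>
     (\<forall>f\<in>L2_centered N. T f \<in> L2_centered N) \<and>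
     (\<forall>f\<in>L2_centered N. \<forall>g\<in>L2_centered N.
        AE x in N. T (\<lambda>x. f x + g x) x = T f x + T g x) \<and>
     (\<forall>c. \<forall>f\<in>L2_centered N. AE x in N. T (\<lambda>x. c * f x) x = c * T f x) \<and>
     (\<exists>C. \<forall>f\<in>L2_centered N. l2_norm N (T f) \<le> C * l2_norm N f)"

definition represents_form ::
    "'a measure \<Rightarrow> (('a \<Rightarrow> real) \<Rightarrow> ('a \<Rightarrow> real)) \<Rightarrow>
     (('a \<Rightarrow> real) \<Rightarrow> ('a \<Rightarrow> real) \<Rightarrow> real) \<Rightarrow> bool" where
  "represents_form N T b \<longleftrightarrow>
     bounded_op N T \<and>
     (\<forall>f\<in>L2_centered N. \<forall>g\<in>L2_centered N. l2_inner N f (T g) = b f g)"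

definition covariance :: "'a measure \<Rightarrow> ('a \<Rightarrow> real) \<Rightarrow> ('a \<Rightarrow> real) \<Rightarrow> real" where
  "covariance M U W =
     (\<integral>\<omega>. (U \<omega> - (\<integral>\<omega>'. U \<omega>' \<partial>M)) * (W \<omega> - (\<integral>\<omega>'. W \<omega>' \<partial>M)) \<partial>M)"

definition dominated :: "'a measure \<Rightarrow> bool" where
  "dominated N \<longleftrightarrow>
     (\<exists>\<mu>. sigma_finite_measure \<mu> \<and> sets \<mu> = sets N \<and> absolutely_continuous \<mu> N)"

definition regular_cond_dist ::
    "'w measure \<Rightarrow> 'a measure \<Rightarrow> 'b measure \<Rightarrow> ('w \<Rightarrow> 'a) \<Rightarrow> ('w \<Rightarrow> 'b) \<Rightarrow>
     ('b \<Rightarrow> 'a measure) \<Rightarrow> bool" where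
  "regular_cond_dist M MX MY X Y \<kappa> \<longleftrightarrow>
     \<kappa> \<in> measurable MY (prob_algebra MX) \<and>
     (\<forall>A\<in>sets MX. \<forall>B\<in>sets MY.
        emeasure M {\<omega> \<in> space M. X \<omega> \<in> A \<and> Y \<omega> \<in> B} =
        (\<integral>\<^sup>+y. emeasure (\<kappa> y) A * indicator B y \<partial>distr M MY Y))"

definition cond_mean :: "('b \<Rightarrow> 'a measure) \<Rightarrow> ('a \<Rightarrow> real) \<Rightarrow> 'b \<Rightarrow> real" where
  "cond_mean \<kappa> f = (\<lambda>y. \<integral>x. f x \<partial>\<kappa> y)"

definition cond_cov ::
    "('b \<Rightarrow> 'a measure) \<Rightarrow> 'b \<Rightarrow> ('a \<Rightarrow> real) \<Rightarrow> ('a \<Rightarrow> real) \<Rightarrow> real" where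
  "cond_cov \<kappa> y f g =
     cond_mean \<kappa> (\<lambda>x. f x * g x) y - cond_mean \<kappa> f y * cond_mean \<kappa> g y"

text \<open>
  The integrability condition makes the values of \<open>cond_cov\<close> genuine conditional covariances
  (the Bochner integral of a non-integrable function is 0). That the form is bounded on
  \<open>L\<^sub>2(P\<^sub>X)\<close>, and hence depends only on classes, is part of \<open>represents_form\<close>.
\<close>

definition cond_variance_operator ::
    "'a measure \<Rightarrow> 'b measure \<Rightarrow> ('b \<Rightarrow> 'a measure) \<Rightarrow>
     ('b \<Rightarrow> ('a \<Rightarrow> real) \<Rightarrow> ('a \<Rightarrow> real)) \<Rightarrow> bool" where
  "cond_variance_operator PX MY \<kappa> VXY \<longleftrightarrow>
     (\<forall>y\<in>space MY.
        (\<forall>f\<in>L2_centered PX. integrable (\<kappa> y) f \<and> integrable (\<kappa> y) (\<lambda>x. (f x)\<^sup>2)) \<and>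
        represents_form PX (VXY y) (cond_cov \<kappa> y))"

definition op_minus ::
    "(('a \<Rightarrow> real) \<Rightarrow> ('a \<Rightarrow> real)) \<Rightarrow> (('a \<Rightarrow> real) \<Rightarrow> ('a \<Rightarrow> real)) \<Rightarrow>
     ('a \<Rightarrow> real) \<Rightarrow> ('a \<Rightarrow> real)" where
  "op_minus T U = (\<lambda>f x. T f x - U f x)"

definition op_expectation ::
    "'b measure \<Rightarrow> ('b \<Rightarrow> ('a \<Rightarrow> real) \<Rightarrow> ('a \<Rightarrow> real)) \<Rightarrow> ('a \<Rightarrow> real) \<Rightarrow> ('a \<Rightarrow> real)" where
  "op_expectation PY A = (\<lambda>f x. \<integral>y. A y f x \<partial>PY)"

text \<open>
  The pointwise integral depends on the chosen representatives of \<open>A y f\<close>; the following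
  states that for the given choice it is meaningful and yields a bounded operator that
  commutes with the inner product.
\<close>

definition has_op_expectation ::
    "'a measure \<Rightarrow> 'b measure \<Rightarrow> ('b \<Rightarrow> ('a \<Rightarrow> real) \<Rightarrow> ('a \<Rightarrow> real)) \<Rightarrow> bool" where
  "has_op_expectation PX PY A \<longleftrightarrow>
     (\<forall>f\<in>L2_centered PX. AE x in PX. integrable PY (\<lambda>y. A y f x)) \<and>
     bounded_op PX (op_expectation PY A) \<and>
     (\<forall>f\<in>L2_centered PX. \<forall>g\<in>L2_centered PX.
        integrable PY (\<lambda>y. l2_inner PX g (A y f)) \<and>
        l2_inner PX g (op_expectation PY A f) = (\<integral>y. l2_inner PX g (A y f) \<partial>PY))"

text \<open>
  \<open>L\<^sub>2(P\<^sub>X)\<close> and \<open>L\<^sub>2(P\<^sub>Y)\<close> become subspaces of \<open>L\<^sub>2(P\<^sub>X\<^sub>Y)\<close> by composing with the projections.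
\<close>

definition embed_fst :: "('a \<Rightarrow> real) set \<Rightarrow> ('a \<times> 'b \<Rightarrow> real) set" where
  "embed_fst A = (\<lambda>f. f \<circ> fst) ` A"

definition embed_snd :: "('b \<Rightarrow> real) set \<Rightarrow> ('a \<times> 'b \<Rightarrow> real) set" where
  "embed_snd B = (\<lambda>g. g \<circ> snd) ` B"

definition regression_class ::
    "'a measure \<Rightarrow> 'b measure \<Rightarrow> ('a \<times> 'b) measure \<Rightarrow> ('a \<times> 'b \<Rightarrow> real) set" where
  "regression_class PX PY PXY =
     ortho_diff PXY (embed_fst (L2_centered PX))
       (ortho_diff PXY (embed_fst (L2_centered PX)) (embed_snd (L2_centered PY)))"

end

theory Submission
  imports Defs
begin

text \<open>
  Write \<open>D y = V - V\<^bsub>X|Y\<^esub>(y)\<close>. The representing form of \<open>D y\<close> is symmetric, so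
  \<open>\<langle>f, S f\<rangle> = \<integral> \<parallel>D y f\<parallel>\<^sup>2 dP\<^sub>Y\<close>. If this vanishes, then \<open>\<langle>f, D y f\<rangle> = 0\<close>, that is
  \<open>var f(X) = var (f(X) | Y = y)\<close>, for almost every \<open>y\<close>. Averaging over \<open>y\<close> and comparing with the
  law of total variance gives \<open>var E(f(X) | Y) = 0\<close>, hence \<open>E(f(X) | Y) = 0\<close> almost surely, and
  disintegration of \<open>P\<^sub>X\<^sub>Y\<close> shows that \<open>f(X)\<close> is orthogonal to \<open>L\<^sub>2(P\<^sub>Y)\<close>.

  So every \<open>k\<close> orthogonal to \<open>ran S\<close>, since it satisfies \<open>\<langle>k, S k\<rangle> = 0\<close>, lies in
  \<open>L\<^sub>2(P\<^sub>X) \<ominus> L\<^sub>2(P\<^sub>Y)\<close> and is therefore orthogonal to the regression class. The inclusion now is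
  the Hilbert space fact that a vector orthogonal to everything orthogonal to a subspace lies in
  the closure of that subspace (\<open>in_l2_closure_if_orthogonal\<close>). It rests on the completeness of
  \<open>L\<^sub>2\<close> (\<open>L2_centered_complete\<close>), both proved here for representatives.
\<close>

section \<open>Square-integrable representatives\<close>

lemma L2_centeredD:
  assumes "f \<in> L2_centered N"
  shows "f \<in> borel_measurable N" "integrable N (\<lambda>x. (f x)\<^sup>2)" "(\<integral>x. f x \<partial>N) = 0"
  using assms by (auto simp: L2_centered_def)

lemma integrable_mult_if_square_integrable:
  fixes f g :: "'a \<Rightarrow> real"
  assumes [measurable]: "f \<in> borel_measurable N" "g \<in> borel_measurable N"
    and "integrable N (\<lambda>x. (f x)\<^sup>2)" "integrable N (\<lambda>x. (g x)\<^sup>2)"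
  shows "integrable N (\<lambda>x. f x * g x)"
proof (rule Bochner_Integration.integrable_bound)
  show "integrable N (\<lambda>x. (f x)\<^sup>2 + (g x)\<^sup>2)" using assms by auto
  have "\<bar>f x * g x\<bar> \<le> (f x)\<^sup>2 + (g x)\<^sup>2" for x
  proof -
    have "2 * (\<bar>f x\<bar> * \<bar>g x\<bar>) \<le> (f x)\<^sup>2 + (g x)\<^sup>2"
      using sum_squares_bound[of "\<bar>f x\<bar>" "\<bar>g x\<bar>"] by (simp add: mult.assoc)
    moreover have "0 \<le> \<bar>f x\<bar> * \<bar>g x\<bar>" by simp
    ultimately show ?thesis unfolding abs_mult by linarith
  qed
  then show "AE x in N. norm (f x * g x) \<le> norm ((f x)\<^sup>2 + (g x)\<^sup>2)"
    by (intro AE_I2) (simp only: real_norm_def abs_of_nonneg sum_power2_ge_zero)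
qed simp

lemma L2_integrable_mult:
  assumes "f \<in> L2_centered N" "g \<in> L2_centered N"
  shows "integrable N (\<lambda>x. f x * g x)"
  by (intro integrable_mult_if_square_integrable L2_centeredD assms)

lemma square_integrable_diff:
  fixes f g :: "'a \<Rightarrow> real"
  assumes [measurable]: "f \<in> borel_measurable N" "g \<in> borel_measurable N"
    and "integrable N (\<lambda>x. (f x)\<^sup>2)" "integrable N (\<lambda>x. (g x)\<^sup>2)"
  shows "integrable N (\<lambda>x. (f x - g x)\<^sup>2)"
  unfolding power2_diff mult.assoc
  using integrable_mult_if_square_integrable[OF assms] assms(3,4) by auto

lemma L2_integrable:
  assumes "prob_space N" "f \<in> L2_centered N"
  shows "integrable N f"
proof -
  interpret prob_space N by fact
  show ?thesis
    using integrable_mult_if_square_integrable[OF _ _ L2_centeredD(2)[OF assms(2)], of "\<lambda>_. 1"]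
      L2_centeredD(1)[OF assms(2)] by simp
qed

lemma l2_inner_commute: "l2_inner N f g = l2_inner N g f"
  by (simp add: l2_inner_def mult.commute)

lemma l2_inner_nonneg [simp]: "0 \<le> l2_inner N f f"
  by (simp add: l2_inner_def)

lemma l2_inner_combination:
  assumes "f \<in> L2_centered N" "g \<in> L2_centered N" "h \<in> L2_centered N"
  shows "l2_inner N (\<lambda>x. a * f x + b * g x) h = a * l2_inner N f h + b * l2_inner N g h"
  using L2_integrable_mult[OF assms(1,3)] L2_integrable_mult[OF assms(2,3)]
  by (simp add: l2_inner_def distrib_right mult.assoc)

lemma L2_centered_combination:
  assumes "prob_space N" and f: "f \<in> L2_centered N" and g: "g \<in> L2_centered N"
  shows "(\<lambda>x. a * f x + b * g x) \<in> L2_centered N"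
proof -
  note D = L2_centeredD[OF f] L2_centeredD[OF g]
  have [measurable]: "f \<in> borel_measurable N" "g \<in> borel_measurable N" by (fact D)+
  have "integrable N (\<lambda>x. (a * f x - (- b) * g x)\<^sup>2)"
  proof (rule square_integrable_diff)
    show "integrable N (\<lambda>x. (a * f x)\<^sup>2)" "integrable N (\<lambda>x. (- b * g x)\<^sup>2)"
      using D(2,5) by (simp_all add: power_mult_distrib)
  qed measurable
  moreover have "(\<integral>x. a * f x + b * g x \<partial>N) = 0"
    using L2_integrable[OF assms(1) f] L2_integrable[OF assms(1) g] D(3,6) by simp
  ultimately show ?thesis
    by (simp add: L2_centered_def)
qed

lemma l2_inner_self_combination:
  assumes "prob_space N" and f: "f \<in> L2_centered N" and g: "g \<in> L2_centered N"
  shows "l2_inner N (\<lambda>x. a * f x + b * g x) (\<lambda>x. a * f x + b * g x)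
    = a\<^sup>2 * l2_inner N f f + 2 * a * b * l2_inner N f g + b\<^sup>2 * l2_inner N g g"
proof -
  let ?c = "\<lambda>x. a * f x + b * g x"
  have "l2_inner N ?c ?c = a * l2_inner N ?c f + b * l2_inner N ?c g"
    using l2_inner_combination[OF f g L2_centered_combination[OF assms, of a b], of a b]
    by (simp only: l2_inner_commute[of N f ?c] l2_inner_commute[of N g ?c])
  also have "\<dots> = a * (a * l2_inner N f f + b * l2_inner N f g)
      + b * (a * l2_inner N f g + b * l2_inner N g g)"
    by (simp only: l2_inner_combination[OF f g f] l2_inner_combination[OF f g g]
        l2_inner_commute[of N g f])
  finally show ?thesis by (simp add: power2_eq_square algebra_simps)
qed

lemma L2_centered_diff:
  assumes "prob_space N" "f \<in> L2_centered N" "g \<in> L2_centered N"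
  shows "(\<lambda>x. f x - g x) \<in> L2_centered N"
  using L2_centered_combination[OF assms, of 1 "-1"] by simp

lemma l2_inner_diff_left:
  assumes "f \<in> L2_centered N" "g \<in> L2_centered N" "h \<in> L2_centered N"
  shows "l2_inner N (\<lambda>x. f x - g x) h = l2_inner N f h - l2_inner N g h"
  using l2_inner_combination[OF assms, of 1 "-1"] by simp

lemma l2_inner_Cauchy_Schwarz:
  assumes "prob_space N" and f: "f \<in> L2_centered N" and g: "g \<in> L2_centered N"
  shows "(l2_inner N f g)\<^sup>2 \<le> l2_inner N f f * l2_inner N g g"
proof -
  let ?F = "l2_inner N f f" and ?G = "l2_inner N g g" and ?p = "l2_inner N f g"
  have quad: "0 \<le> a\<^sup>2 * ?F + 2 * a * b * ?p + b\<^sup>2 * ?G" for a b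
    using l2_inner_self_combination[OF assms, of a b]
      l2_inner_nonneg[of N "\<lambda>x. a * f x + b * g x"] by linarith
  show ?thesis
  proof (cases "?G = 0")
    case True
    \<comment> \<open>The form is then affine in \<open>b\<close> and bounded below, so its slope \<open>2 * ?p\<close> is 0.\<close>
    have "?p = 0"
    proof (rule ccontr)
      assume "?p \<noteq> 0"
      then show False
        using quad[of 1 "- (?F + 1) / (2 * ?p)"] True by (simp add: field_simps)
    qed
    then show ?thesis by simp
  next
    case False
    then have G: "?G > 0" using l2_inner_nonneg[of N g] by linarith
    \<comment> \<open>The minimising ratio \<open>b / a = - ?p / ?G\<close>, cleared of its denominator.\<close>
    have "0 \<le> ?G * (?F * ?G - ?p\<^sup>2)"
      using quad[of ?G "- ?p"] by (simp add: power2_eq_square algebra_simps)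
    then show ?thesis using G by (simp add: zero_le_mult_iff)
  qed
qed

lemma l2_inner_tendsto:
  assumes "prob_space N" and "\<And>n. u n \<in> L2_centered N" "k \<in> L2_centered N" "a \<in> L2_centered N"
    and lim: "(\<lambda>n. l2_inner N (\<lambda>x. u n x - k x) (\<lambda>x. u n x - k x)) \<longlonglongrightarrow> 0"
  shows "(\<lambda>n. l2_inner N (u n) a) \<longlonglongrightarrow> l2_inner N k a"
proof -
  let ?w = "\<lambda>n x. u n x - k x"
  have "(\<lambda>n. (l2_inner N (?w n) a)\<^sup>2) \<longlonglongrightarrow> 0"
  proof (rule tendsto_sandwich[OF _ _ tendsto_const])
    show "(\<lambda>n. l2_inner N (?w n) (?w n) * l2_inner N a a) \<longlonglongrightarrow> 0"
      using tendsto_mult_left_zero[OF lim] by simp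
    show "\<forall>\<^sub>F n in sequentially.
        (l2_inner N (?w n) a)\<^sup>2 \<le> l2_inner N (?w n) (?w n) * l2_inner N a a"
      using assms by (intro always_eventually allI l2_inner_Cauchy_Schwarz L2_centered_diff)
  qed simp
  then have "(\<lambda>n. l2_inner N (?w n) a) \<longlonglongrightarrow> 0"
    using tendsto_real_sqrt[of "\<lambda>n. (l2_inner N (?w n) a)\<^sup>2" 0 sequentially]
    by (simp add: tendsto_rabs_zero_iff)
  then show ?thesis
    using assms by (simp add: l2_inner_diff_left LIM_zero_iff)
qed

section \<open>Completeness and closures of subspaces\<close>

lemma abs_le_scaled_square:
  fixes w :: real
  shows "\<bar>w\<bar> \<le> 2 ^ n * w\<^sup>2 + (1/2) ^ n"
proof -
  have "0 \<le> (2 ^ n * \<bar>w\<bar> - 1)\<^sup>2" by simp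
  then have "2 * (2 ^ n * \<bar>w\<bar>) \<le> 2 ^ n * (2 ^ n * w\<^sup>2) + 1"
    by (simp add: power2_diff power_mult_distrib power2_eq_square algebra_simps)
  then have "2 * \<bar>w\<bar> \<le> 2 ^ n * w\<^sup>2 + (1/2) ^ n"
    by (simp add: power_one_over field_simps)
  then show ?thesis using abs_ge_zero[of w] by linarith
qed

text \<open>Young's inequality with weight \<open>2\<^sup>n\<close> turns the \<open>L\<^sub>2\<close> rate \<open>2\<^sup>-\<^sup>n\<close> into an \<open>L\<^sub>1\<close> rate of the
  same order, without a Cauchy--Schwarz argument against the constant 1.\<close>

lemma L1_bound_from_L2_bound:
  fixes w :: "'a \<Rightarrow> real"
  assumes "prob_space N" and [measurable]: "w \<in> borel_measurable N"
    and sq: "integrable N (\<lambda>x. (w x)\<^sup>2)" "(\<integral>x. (w x)\<^sup>2 \<partial>N) \<le> (1/4) ^ n"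
  shows "integrable N w" "(\<integral>x. \<bar>w x\<bar> \<partial>N) \<le> 2 * (1/2) ^ n"
proof -
  interpret prob_space N by fact
  have bound: "integrable N (\<lambda>x. 2 ^ n * (w x)\<^sup>2 + (1/2) ^ n)" using sq by simp
  show int: "integrable N w"
    by (rule Bochner_Integration.integrable_bound[OF bound])
      (auto intro!: AE_I2 order_trans[OF abs_le_scaled_square])
  have "(\<integral>x. \<bar>w x\<bar> \<partial>N) \<le> (\<integral>x. 2 ^ n * (w x)\<^sup>2 + (1/2) ^ n \<partial>N)"
    using int bound by (intro integral_mono abs_le_scaled_square) auto
  also have "\<dots> = 2 ^ n * (\<integral>x. (w x)\<^sup>2 \<partial>N) + (1/2) ^ n"
    using sq by (simp add: prob_space)
  also have "\<dots> \<le> 2 ^ n * (1/4) ^ n + (1/2) ^ n"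
    using sq(2) by (intro add_right_mono mult_left_mono) auto
  also have "2 ^ n * (1/4) ^ n = ((1/2) ^ n :: real)"
    by (simp only: power_mult_distrib[symmetric]) simp
  finally show "(\<integral>x. \<bar>w x\<bar> \<partial>N) \<le> 2 * (1/2) ^ n" by simp
qed

text \<open>
  Riesz--Fischer. The increments have summable \<open>L\<^sub>1\<close> norms, so almost everywhere they form an
  absolutely convergent series and the sequence has a pointwise limit; Fatou's lemma transfers
  the Cauchy bound to that limit.
\<close>

lemma L2_centered_complete:
  assumes "prob_space N" and u: "\<And>n. u n \<in> L2_centered N"
    and cauchy: "\<And>n m. n \<le> m \<Longrightarrow> (\<integral>x. (u m x - u n x)\<^sup>2 \<partial>N) \<le> (1/4) ^ n"
  obtains k where "k \<in> L2_centered N"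
    "(\<lambda>n. l2_inner N (\<lambda>x. u n x - k x) (\<lambda>x. u n x - k x)) \<longlonglongrightarrow> 0"
proof -
  interpret prob_space N by fact
  have um [measurable]: "u n \<in> borel_measurable N" for n by (rule L2_centeredD[OF u])
  define k where "k = (\<lambda>x. lim (\<lambda>n. u n x))"
  have km [measurable]: "k \<in> borel_measurable N" unfolding k_def by measurable
  have sq_diff: "integrable N (\<lambda>x. (u m x - u n x)\<^sup>2)" for m n
    by (intro square_integrable_diff um L2_centeredD[OF u])
  let ?w = "\<lambda>n x. u (Suc n) x - u n x"
  have L1: "(\<integral>\<^sup>+x. ennreal \<bar>?w n x\<bar> \<partial>N) \<le> ennreal (2 * (1/2) ^ n)" for n
  proof -
    have wm: "?w n \<in> borel_measurable N" by measurable
    note w = L1_bound_from_L2_bound[OF assms(1) wm sq_diff cauchy[of n "Suc n"]]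
    have "integrable N (?w n)" and le: "(\<integral>x. \<bar>?w n x\<bar> \<partial>N) \<le> 2 * (1/2) ^ n"
      by (intro w; simp)+
    then have "(\<integral>\<^sup>+x. ennreal \<bar>?w n x\<bar> \<partial>N) = ennreal (\<integral>x. \<bar>?w n x\<bar> \<partial>N)"
      by (intro nn_integral_eq_integral) auto
    with le show ?thesis by (auto intro: ennreal_leI)
  qed
  have "(\<integral>\<^sup>+x. (\<Sum>n. ennreal \<bar>?w n x\<bar>) \<partial>N) = (\<Sum>n. \<integral>\<^sup>+x. ennreal \<bar>?w n x\<bar> \<partial>N)"
    by (intro nn_integral_suminf) auto
  also have "\<dots> \<le> (\<Sum>n. ennreal (2 * (1/2) ^ n))"
    by (rule suminf_le[OF L1 summableI summableI])
  also have "\<dots> < \<infinity>"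
  proof -
    have "summable (\<lambda>n. 2 * (1/2) ^ n :: real)"
      by (intro summable_mult summable_geometric) simp
    then have "(\<Sum>n. ennreal (2 * (1/2) ^ n)) \<noteq> top"
      by (rule ennreal_suminf_neq_top) simp
    then show ?thesis unfolding infinity_ennreal_def less_top .
  qed
  finally have "AE x in N. (\<Sum>n. ennreal \<bar>?w n x\<bar>) \<noteq> \<infinity>"
    by (intro nn_integral_PInf_AE) simp_all
  then have lim: "AE x in N. (\<lambda>n. u n x) \<longlonglongrightarrow> k x"
  proof eventually_elim
    case (elim x)
    then have "summable (\<lambda>n. \<bar>?w n x\<bar>)"
      by (intro summable_suminf_not_top) auto
    then have "summable (\<lambda>n. ?w n x)" by (rule summable_rabs_cancel)
    then have "convergent (\<lambda>n. \<Sum>i<n. ?w i x)" by (simp add: summable_iff_convergent)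
    then have "convergent (\<lambda>n. (\<Sum>i<n. ?w i x) + u 0 x)"
      by (intro convergent_add convergent_const)
    then have "convergent (\<lambda>n. u n x)" by (simp add: sum_lessThan_telescope[of "\<lambda>n. u n x"])
    then show ?case unfolding k_def by (simp add: convergent_LIMSEQ_iff)
  qed
  have nn: "(\<integral>\<^sup>+x. ennreal ((u n x - k x)\<^sup>2) \<partial>N) \<le> ennreal ((1/4) ^ n)" for n
  proof -
    have "(\<integral>\<^sup>+x. ennreal ((u n x - k x)\<^sup>2) \<partial>N)
        = (\<integral>\<^sup>+x. liminf (\<lambda>m. ennreal ((u n x - u m x)\<^sup>2)) \<partial>N)"
    proof (rule nn_integral_cong_AE, use lim in eventually_elim)
      case (elim x)
      then have "(\<lambda>m. ennreal ((u n x - u m x)\<^sup>2)) \<longlonglongrightarrow> ennreal ((u n x - k x)\<^sup>2)"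
        by (intro tendsto_intros)
      then show ?case by (intro lim_imp_Liminf[symmetric]) auto
    qed
    also have "\<dots> \<le> liminf (\<lambda>m. \<integral>\<^sup>+x. ennreal ((u n x - u m x)\<^sup>2) \<partial>N)"
      by (intro nn_integral_liminf) auto
    also have "\<dots> \<le> limsup (\<lambda>m. \<integral>\<^sup>+x. ennreal ((u n x - u m x)\<^sup>2) \<partial>N)"
      by (intro Liminf_le_Limsup) simp
    also have "\<dots> \<le> ennreal ((1/4) ^ n)"
    proof (intro Limsup_bounded, use eventually_ge_at_top[of n] in eventually_elim)
      case (elim m)
      have "(\<integral>\<^sup>+x. ennreal ((u n x - u m x)\<^sup>2) \<partial>N) = ennreal (\<integral>x. (u m x - u n x)\<^sup>2 \<partial>N)"
        using nn_integral_eq_integral[OF sq_diff[of n m]] by (simp add: power2_commute)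
      then show ?case using cauchy[OF elim] by (auto intro: ennreal_leI)
    qed
    finally show ?thesis .
  qed
  have sq_k: "integrable N (\<lambda>x. (u n x - k x)\<^sup>2)" for n
    using nn[of n] by (intro integrableI_bounded) (auto intro: le_less_trans)
  have bound_k: "(\<integral>x. (u n x - k x)\<^sup>2 \<partial>N) \<le> (1/4) ^ n" for n
    using nn[of n] nn_integral_eq_integral[OF sq_k[of n]] by simp
  have k: "k \<in> L2_centered N"
  proof -
    have "integrable N (\<lambda>x. (u 0 x - (u 0 x - k x))\<^sup>2)"
      by (intro square_integrable_diff sq_k L2_centeredD(2)[OF u]) measurable
    then have sq: "integrable N (\<lambda>x. (k x)\<^sup>2)" by simp
    have int: "integrable N k"
      using integrable_mult_if_square_integrable[of k N "\<lambda>_. 1"] sq by simp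
    \<comment> \<open>The limit inherits mean zero because \<open>L\<^sub>2\<close> convergence implies \<open>L\<^sub>1\<close> convergence.\<close>
    have "\<bar>\<integral>x. k x \<partial>N\<bar> \<le> 2 * (1/2) ^ n" for n
    proof -
      have "(\<integral>x. k x \<partial>N) = - (\<integral>x. u n x - k x \<partial>N)"
        using int L2_integrable[OF assms(1) u[of n]] L2_centeredD(3)[OF u[of n]] by simp
      also have "\<bar>\<dots>\<bar> \<le> (\<integral>x. \<bar>u n x - k x\<bar> \<partial>N)"
        by simp
      also have "\<dots> \<le> 2 * (1/2) ^ n"
        by (rule L1_bound_from_L2_bound(2)[OF assms(1) _ sq_k bound_k]) measurable
      finally show ?thesis .
    qed
    moreover have "(\<lambda>n. 2 * (1/2) ^ n :: real) \<longlonglongrightarrow> 0"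
      by (intro tendsto_mult_right_zero LIMSEQ_realpow_zero) auto
    ultimately have "\<bar>\<integral>x. k x \<partial>N\<bar> \<le> 0"
      using LIMSEQ_le_const by blast
    then show ?thesis using sq by (simp add: L2_centered_def)
  qed
  have "(\<lambda>n. \<integral>x. (u n x - k x)\<^sup>2 \<partial>N) \<longlonglongrightarrow> 0"
  proof (rule tendsto_sandwich[OF _ _ tendsto_const])
    show "(\<lambda>n. (1/4) ^ n :: real) \<longlonglongrightarrow> 0" by (intro LIMSEQ_realpow_zero) auto
  qed (auto simp: bound_k)
  with k show thesis by (intro that) (auto simp: l2_inner_def power2_eq_square)
qed

lemma zero_if_linear_le_quadratic:
  fixes p q :: real
  assumes "\<And>t. 2 * t * p \<le> t\<^sup>2 * q" "0 \<le> q"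
  shows "p = 0"
proof (rule ccontr)
  assume "p \<noteq> 0"
  \<comment> \<open>The denominator \<open>q + 1\<close> also serves the case \<open>q = 0\<close>.\<close>
  have "2 * (p / (q + 1)) * p \<le> (p / (q + 1))\<^sup>2 * q" by (rule assms)
  then have "2 * (p / (q + 1)) * p * (q + 1)\<^sup>2 \<le> (p / (q + 1))\<^sup>2 * q * (q + 1)\<^sup>2"
    by (rule mult_right_mono) simp
  moreover have "2 * (p / (q + 1)) * p * (q + 1)\<^sup>2 = 2 * p\<^sup>2 * (q + 1)"
    "(p / (q + 1))\<^sup>2 * q * (q + 1)\<^sup>2 = p\<^sup>2 * q"
    using assms(2) by (simp_all add: power2_eq_square)
  ultimately have "2 * p\<^sup>2 * (q + 1) \<le> p\<^sup>2 * q" by simp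
  then have "p\<^sup>2 * (q + 2) \<le> 0" by (simp add: algebra_simps)
  then show False using \<open>p \<noteq> 0\<close> assms(2) by (simp add: mult_le_0_iff)
qed

text \<open>
  The residuals \<open>h - g\<^sub>n\<close> of a minimising sequence \<open>g\<^sub>n\<close> in \<open>A\<close> are Cauchy by the parallelogram
  law. Minimality makes their limit \<open>k\<close> orthogonal to \<open>A\<close>, and then
  \<open>\<parallel>k\<parallel>\<^sup>2 = lim \<langle>h - g\<^sub>n, k\<rangle> = \<langle>h, k\<rangle> = 0\<close>, so \<open>g\<^sub>n\<close> converges to \<open>h\<close>. The set \<open>A\<close> is a subspace only up to
  null sets, which is how the range of an operator on representatives presents itself.
\<close>

lemma in_l2_closure_if_orthogonal:
  assumes N: "prob_space N" and A: "A \<subseteq> L2_centered N" "A \<noteq> {}"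
    and lin: "\<And>a b s t. a \<in> A \<Longrightarrow> b \<in> A \<Longrightarrow> \<exists>c\<in>A. AE x in N. c x = s * a x + t * b x"
    and h: "h \<in> L2_centered N"
    and orth: "\<And>k. k \<in> L2_centered N \<Longrightarrow> (\<And>a. a \<in> A \<Longrightarrow> l2_inner N k a = 0)
      \<Longrightarrow> l2_inner N h k = 0"
  shows "h \<in> l2_closure N A"
proof -
  define Q where "Q = (\<lambda>g. l2_inner N (\<lambda>x. h x - g x) (\<lambda>x. h x - g x))"
  define d where "d = Inf (Q ` A)"
  have Q0: "0 \<le> Q g" for g by (simp add: Q_def)
  have bdd: "bdd_below (Q ` A)" using Q0 by (intro bdd_belowI[where m = 0]) auto
  have d_le: "d \<le> Q g" if "g \<in> A" for g
    unfolding d_def using bdd that by (intro cInf_lower) auto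
  have d_le': "d \<le> Q (\<lambda>x. s * a x + t * b x)" if ab: "a \<in> A" "b \<in> A" for a b s t
  proof -
    obtain c where c: "c \<in> A" "AE x in N. c x = s * a x + t * b x"
      using lin[OF ab] by blast
    have [measurable]: "a \<in> borel_measurable N" "b \<in> borel_measurable N"
      "c \<in> borel_measurable N" "h \<in> borel_measurable N"
      using A(1) ab c h by (auto intro: L2_centeredD(1))
    have "Q c = Q (\<lambda>x. s * a x + t * b x)"
      unfolding Q_def l2_inner_def by (rule integral_cong_AE) (use c(2) in auto)
    with d_le[OF c(1)] show ?thesis by simp
  qed
  \<comment> \<open>The tolerance is chosen so that the parallelogram law yields the rate \<open>4\<^sup>-\<^sup>n\<close>.\<close>
  define e :: "nat \<Rightarrow> real" where "e n = (1/4) ^ n / 4" for n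
  have "\<exists>g\<in>A. Q g < d + e n" for n
  proof -
    have "Inf (Q ` A) < d + e n" by (simp add: d_def e_def)
    then show ?thesis using A(2) bdd by (auto simp: cInf_less_iff)
  qed
  then obtain g where gA: "g n \<in> A" and gQ: "Q (g n) < d + e n" for n by metis
  define u where "u n = (\<lambda>x. h x - g n x)" for n
  have gL: "g n \<in> L2_centered N" for n using gA A(1) by blast
  have uL: "u n \<in> L2_centered N" for n
    unfolding u_def by (intro L2_centered_diff N h gL)
  have uu: "l2_inner N (u n) (u n) = Q (g n)" for n by (simp add: u_def Q_def)
  have cauchy: "(\<integral>x. (u m x - u n x)\<^sup>2 \<partial>N) \<le> (1/4) ^ n" if "n \<le> m" for m n
  proof -
    define mid where "mid = (\<lambda>x. 1/2 * g m x + 1/2 * g n x)"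
    have "(\<integral>x. (u m x - u n x)\<^sup>2 \<partial>N)
        = l2_inner N (\<lambda>x. 1 * u m x + (-1) * u n x) (\<lambda>x. 1 * u m x + (-1) * u n x)"
      by (simp add: l2_inner_def power2_eq_square)
    also have "\<dots> = 2 * Q (g m) + 2 * Q (g n)
        - 4 * l2_inner N (\<lambda>x. 1/2 * u m x + 1/2 * u n x) (\<lambda>x. 1/2 * u m x + 1/2 * u n x)"
      unfolding l2_inner_self_combination[OF N uL uL]
      by (simp add: uu field_simps power2_eq_square)
    also have "(\<lambda>x. 1/2 * u m x + 1/2 * u n x) = (\<lambda>x. h x - mid x)"
      by (auto simp: u_def mid_def field_simps)
    also have "l2_inner N (\<lambda>x. h x - mid x) (\<lambda>x. h x - mid x) = Q mid"
      by (simp only: Q_def)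
    also have "2 * Q (g m) + 2 * Q (g n) - 4 * Q mid
        \<le> 2 * e m + 2 * e n"
      using gQ[of m] gQ[of n] d_le'[OF gA[of m] gA[of n], of "1/2" "1/2", folded mid_def]
      by linarith
    also have "\<dots> \<le> (1/4) ^ n"
    proof -
      have "(1/4) ^ m \<le> (1/4 :: real) ^ n" using that by (intro power_decreasing) auto
      then show ?thesis unfolding e_def by linarith
    qed
    finally show ?thesis .
  qed
  obtain k where k: "k \<in> L2_centered N"
    and lim: "(\<lambda>n. l2_inner N (\<lambda>x. u n x - k x) (\<lambda>x. u n x - k x)) \<longlonglongrightarrow> 0"
    by (rule L2_centered_complete[OF N uL cauchy])
  note tends = l2_inner_tendsto[OF N uL k _ lim]
  have kA: "l2_inner N k a = 0" if a: "a \<in> A" for a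
  proof (rule zero_if_linear_le_quadratic)
    have aL: "a \<in> L2_centered N" using a A(1) by blast
    fix t :: real
    have "2 * t * l2_inner N (u n) a \<le> t\<^sup>2 * l2_inner N a a + e n" for n
    proof -
      have "d \<le> Q (\<lambda>x. 1 * g n x + t * a x)" by (rule d_le'[OF gA a])
      also have "(\<lambda>x. h x - (1 * g n x + t * a x)) = (\<lambda>x. 1 * u n x + (- t) * a x)"
        by (auto simp: u_def)
      then have "Q (\<lambda>x. 1 * g n x + t * a x)
          = l2_inner N (\<lambda>x. 1 * u n x + (- t) * a x) (\<lambda>x. 1 * u n x + (- t) * a x)"
        unfolding Q_def by simp
      also have "\<dots> = Q (g n) - 2 * t * l2_inner N (u n) a + t\<^sup>2 * l2_inner N a a"
        unfolding l2_inner_self_combination[OF N uL aL] by (simp add: uu)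
      finally show ?thesis using gQ[of n] by linarith
    qed
    moreover have "(\<lambda>n. 2 * t * l2_inner N (u n) a) \<longlonglongrightarrow> 2 * t * l2_inner N k a"
      by (intro tendsto_intros tends aL)
    moreover have "(\<lambda>n. t\<^sup>2 * l2_inner N a a + e n) \<longlonglongrightarrow> t\<^sup>2 * l2_inner N a a + 0 / 4"
      unfolding e_def by (intro tendsto_intros LIMSEQ_realpow_zero) auto
    ultimately show "2 * t * l2_inner N k a \<le> t\<^sup>2 * l2_inner N a a"
      by (intro LIMSEQ_le[where X = "\<lambda>n. 2 * t * l2_inner N (u n) a"
            and Y = "\<lambda>n. t\<^sup>2 * l2_inner N a a + e n"]) auto
  qed simp
  have uk: "l2_inner N (u n) k = 0" for n
    using orth[OF k kA] kA[OF gA[of n]]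
    by (simp add: u_def l2_inner_diff_left[OF h gL k] l2_inner_commute[of N "g n"])
  then have kk: "l2_inner N k k = 0"
    using tends[OF k] by (simp add: uk LIMSEQ_const_iff)
  have "l2_inner N (\<lambda>x. u n x - k x) (\<lambda>x. u n x - k x) = Q (g n)" for n
    using l2_inner_self_combination[OF N uL k, of 1 n "-1"] kk uk
    by (simp add: uu)
  with lim have "(\<lambda>n. Q (g n)) \<longlonglongrightarrow> 0" by simp
  then have "(\<lambda>n. sqrt (Q (g n))) \<longlonglongrightarrow> 0"
    using tendsto_real_sqrt[of _ 0] by fastforce
  moreover have "sqrt (Q (g n)) = l2_norm N (\<lambda>x. g n x - h x)" for n
    by (simp add: Q_def l2_norm_def l2_inner_def power2_commute flip: power2_eq_square)
  ultimately have conv: "(\<lambda>n. l2_norm N (\<lambda>x. g n x - h x)) \<longlonglongrightarrow> 0" by simp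
  show ?thesis
    unfolding l2_closure_def
  proof (intro CollectI conjI h allI impI)
    fix e :: real assume "e > 0"
    then have "\<forall>\<^sub>F n in sequentially. l2_norm N (\<lambda>x. g n x - h x) < e"
      using order_tendstoD(2)[OF conv] by blast
    then obtain n where "l2_norm N (\<lambda>x. g n x - h x) < e"
      by (auto simp: eventually_sequentially)
    with gA[of n] show "\<exists>g\<in>A. l2_norm N (\<lambda>x. g x - h x) < e" by blast
  qed
qed

section \<open>Regular conditional distributions\<close>

text \<open>
  The defining identity of a regular conditional distribution says that the joint law and the
  mixture \<open>PY \<bind> K\<close> of the laws \<open>K y\<close> of \<open>(x, y)\<close>, with \<open>x\<close> drawn from \<open>\<kappa> y\<close>, agree on rectangles. These
  are stable under intersection and generate the product, so the two measures coincide.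
\<close>

lemma nn_integral_disintegration:
  assumes [measurable]: "X \<in> measurable M MX" "Y \<in> measurable M MY"
    and "prob_space M" and rcd: "regular_cond_dist M MX MY X Y \<kappa>"
    and f: "f \<in> borel_measurable (MX \<Otimes>\<^sub>M MY)"
  shows "(\<integral>\<^sup>+z. f z \<partial>distr M (MX \<Otimes>\<^sub>M MY) (\<lambda>\<omega>. (X \<omega>, Y \<omega>)))
    = (\<integral>\<^sup>+y. \<integral>\<^sup>+x. f (x, y) \<partial>\<kappa> y \<partial>distr M MY Y)"
proof -
  interpret prob_space M by fact
  let ?P = "distr M (MX \<Otimes>\<^sub>M MY) (\<lambda>\<omega>. (X \<omega>, Y \<omega>))" and ?PY = "distr M MY Y"
  define K where "K = (\<lambda>y. distr (\<kappa> y) (MX \<Otimes>\<^sub>M MY) (\<lambda>x. (x, y)))"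
  have kernel: "\<kappa> \<in> measurable MY (subprob_algebra MX)"
    and rect: "\<And>A B. A \<in> sets MX \<Longrightarrow> B \<in> sets MY \<Longrightarrow>
      emeasure M {\<omega> \<in> space M. X \<omega> \<in> A \<and> Y \<omega> \<in> B}
        = (\<integral>\<^sup>+y. emeasure (\<kappa> y) A * indicator B y \<partial>?PY)"
    using rcd by (auto simp: regular_cond_dist_def intro: measurable_prob_algebraD)
  have sets_\<kappa>: "sets (\<kappa> y) = sets MX" if "y \<in> space MY" for y
    using kernel that by (rule sets_kernel)
  have K: "K \<in> measurable ?PY (subprob_algebra (MX \<Otimes>\<^sub>M MY))"
  proof -
    have "K \<in> measurable MY (subprob_algebra (MX \<Otimes>\<^sub>M MY))"
      unfolding K_def by (rule measurable_distr2[OF _ kernel]) measurable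
    then show ?thesis by simp
  qed
  have PY_ne: "space ?PY \<noteq> {}"
    using not_empty measurable_space[OF assms(2)] by auto
  have "?P = ?PY \<bind> K"
  proof (rule measure_eqI_generator_eq)
    let ?E = "{A \<times> B | A B. A \<in> sets MX \<and> B \<in> sets MY}"
    show "Int_stable ?E" by (rule Int_stable_pair_measure_generator)
    show "?E \<subseteq> Pow (space MX \<times> space MY)" by (rule pair_measure_closed)
    show "sets ?P = sigma_sets (space MX \<times> space MY) ?E"
      by (simp add: sets_pair_measure)
    have "sets (?PY \<bind> K) = sets (MX \<Otimes>\<^sub>M MY)"
      by (rule sets_bind[OF sets_kernel[OF K] PY_ne])
    then show "sets (?PY \<bind> K) = sigma_sets (space MX \<times> space MY) ?E"
      by (simp add: sets_pair_measure)
    show "range (\<lambda>_ :: nat. space MX \<times> space MY) \<subseteq> ?E" by blast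
    show "(\<Union>_ :: nat. space MX \<times> space MY) = space MX \<times> space MY" by blast
    show "emeasure ?P (space MX \<times> space MY) \<noteq> \<infinity>" for i :: nat
    proof -
      interpret P: prob_space ?P by (rule prob_space_distr) measurable
      show ?thesis by simp
    qed
    fix C assume "C \<in> ?E"
    then obtain A B where C: "C = A \<times> B" and A: "A \<in> sets MX" and B: "B \<in> sets MY" by blast
    have "emeasure ?P C = emeasure M {\<omega> \<in> space M. X \<omega> \<in> A \<and> Y \<omega> \<in> B}"
      using A B by (subst emeasure_distr) (auto simp: C intro!: arg_cong[where f = "emeasure M"])
    also have "\<dots> = (\<integral>\<^sup>+y. emeasure (\<kappa> y) A * indicator B y \<partial>?PY)"
      by (rule rect[OF A B])
    also have "\<dots> = (\<integral>\<^sup>+y. emeasure (K y) C \<partial>?PY)"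
    proof (rule nn_integral_cong)
      fix y assume "y \<in> space ?PY"
      then have y: "y \<in> space MY" by simp
      have "emeasure (K y) C = emeasure (\<kappa> y) ((\<lambda>x. (x, y)) -` C \<inter> space (\<kappa> y))"
        unfolding K_def using A B y
        by (intro emeasure_distr) (auto simp: C cong: measurable_cong_sets[OF sets_\<kappa>[OF y] refl])
      also have "(\<lambda>x. (x, y)) -` C \<inter> space (\<kappa> y) = (if y \<in> B then A else {})"
        using sets.sets_into_space[OF A] sets_eq_imp_space_eq[OF sets_\<kappa>[OF y]] by (auto simp: C)
      finally show "emeasure (\<kappa> y) A * indicator B y = emeasure (K y) C"
        by (simp add: indicator_def)
    qed
    also have "\<dots> = emeasure (?PY \<bind> K) C"
      using A B by (intro emeasure_bind[symmetric, OF PY_ne K]) (simp add: C)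
    finally show "emeasure ?P C = emeasure (?PY \<bind> K) C" .
  qed
  then have "(\<integral>\<^sup>+z. f z \<partial>?P) = (\<integral>\<^sup>+y. \<integral>\<^sup>+z. f z \<partial>K y \<partial>?PY)"
    by (simp only: nn_integral_bind[OF f K])
  also have "\<dots> = (\<integral>\<^sup>+y. \<integral>\<^sup>+x. f (x, y) \<partial>\<kappa> y \<partial>?PY)"
  proof (rule nn_integral_cong)
    fix y assume "y \<in> space ?PY"
    then have y: "y \<in> space MY" by simp
    have "(\<lambda>x. (x, y)) \<in> measurable (\<kappa> y) (MX \<Otimes>\<^sub>M MY)"
      unfolding measurable_cong_sets[OF sets_\<kappa>[OF y] refl] using y by measurable
    then show "(\<integral>\<^sup>+z. f z \<partial>K y) = (\<integral>\<^sup>+x. f (x, y) \<partial>\<kappa> y)"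
      unfolding K_def using f by (intro nn_integral_distr) simp_all
  qed
  finally show ?thesis .
qed

lemma borel_measurable_cond_mean:
  assumes "regular_cond_dist M MX MY X Y \<kappa>" and "f \<in> borel_measurable MX"
  shows "cond_mean \<kappa> f \<in> borel_measurable MY"
  unfolding cond_mean_def
  using assms by (intro measurable_compose[OF _ integral_measurable_subprob_algebra])
    (auto simp: regular_cond_dist_def intro: measurable_prob_algebraD)

text \<open>
  The law of total variance in a degenerate case: with \<open>c = E f\<^sup>2\<close> equal to the conditional
  variance, averaging \<open>E(f\<^sup>2 | y) = c + (E(f | y))\<^sup>2\<close> gives \<open>c = c + \<integral> (E(f | y))\<^sup>2 dP\<^sub>Y\<close>.
\<close>

lemma cond_mean_eq_0_if_cond_variance_eq_second_moment:
  assumes M: "prob_space M"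
    and X [measurable]: "X \<in> measurable M MX" and Y [measurable]: "Y \<in> measurable M MY"
    and rcd: "regular_cond_dist M MX MY X Y \<kappa>"
    and [measurable]: "f \<in> borel_measurable MX"
    and sq: "integrable (distr M MX X) (\<lambda>x. (f x)\<^sup>2)"
    and int: "\<And>y. y \<in> space MY \<Longrightarrow> integrable (\<kappa> y) (\<lambda>x. (f x)\<^sup>2)"
    and var: "AE y in distr M MY Y. cond_cov \<kappa> y f f = (\<integral>x. (f x)\<^sup>2 \<partial>distr M MX X)"
  shows "AE y in distr M MY Y. cond_mean \<kappa> f y = 0"
proof -
  interpret prob_space M by fact
  let ?PX = "distr M MX X" and ?PY = "distr M MY Y"
  interpret PY: prob_space ?PY by (rule prob_space_distr) measurable
  define c where "c = (\<integral>x. (f x)\<^sup>2 \<partial>?PX)"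
  have c: "0 \<le> c" by (simp add: c_def)
  have m [measurable]: "cond_mean \<kappa> f \<in> borel_measurable MY"
    using rcd by (rule borel_measurable_cond_mean) measurable
  have "ennreal c = (\<integral>\<^sup>+x. ennreal ((f x)\<^sup>2) \<partial>?PX)"
    unfolding c_def using sq by (intro nn_integral_eq_integral[symmetric]) auto
  also have "\<dots> = (\<integral>\<^sup>+z. ennreal ((f (fst z))\<^sup>2) \<partial>distr M (MX \<Otimes>\<^sub>M MY) (\<lambda>\<omega>. (X \<omega>, Y \<omega>)))"
    by (simp add: nn_integral_distr)
  also have "\<dots> = (\<integral>\<^sup>+y. \<integral>\<^sup>+x. ennreal ((f x)\<^sup>2) \<partial>\<kappa> y \<partial>?PY)"
    by (subst nn_integral_disintegration[OF X Y M rcd]) simp_all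
  also have "\<dots> = (\<integral>\<^sup>+y. ennreal c + ennreal ((cond_mean \<kappa> f y)\<^sup>2) \<partial>?PY)"
  proof (rule nn_integral_cong_AE, use var AE_space in eventually_elim)
    case (elim y)
    have "(\<integral>\<^sup>+x. ennreal ((f x)\<^sup>2) \<partial>\<kappa> y) = ennreal (\<integral>x. (f x)\<^sup>2 \<partial>\<kappa> y)"
      using int elim(2) by (intro nn_integral_eq_integral) auto
    also have "(\<integral>x. (f x)\<^sup>2 \<partial>\<kappa> y) = c + (cond_mean \<kappa> f y)\<^sup>2"
      using elim(1) by (simp add: cond_cov_def cond_mean_def c_def power2_eq_square)
    finally show ?case using c by simp
  qed
  also have "\<dots> = ennreal c + (\<integral>\<^sup>+y. ennreal ((cond_mean \<kappa> f y)\<^sup>2) \<partial>?PY)"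
    by (subst nn_integral_add) (use PY.emeasure_space_1 in auto)
  finally have "ennreal c + 0 = ennreal c + (\<integral>\<^sup>+y. ennreal ((cond_mean \<kappa> f y)\<^sup>2) \<partial>?PY)"
    by simp
  then have "(\<integral>\<^sup>+y. ennreal ((cond_mean \<kappa> f y)\<^sup>2) \<partial>?PY) = 0"
    by (subst (asm) ennreal_add_left_cancel) simp
  then have "AE y in ?PY. ennreal ((cond_mean \<kappa> f y)\<^sup>2) = 0"
    by (subst (asm) nn_integral_0_iff_AE) simp_all
  then show ?thesis by eventually_elim simp
qed

text \<open>
  For almost every \<open>y\<close>, the positive and negative parts of \<open>f(x) g(y)\<close> have equal
  \<open>\<kappa> y\<close>-integrals, and by
  disintegration so do those of \<open>f(X) g(Y)\<close>. Should these be infinite, the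
  integral in \<open>l2_inner\<close> takes its default value 0.
\<close>

lemma orthogonal_if_cond_mean_eq_0:
  assumes M: "prob_space M"
    and X [measurable]: "X \<in> measurable M MX" and Y [measurable]: "Y \<in> measurable M MY"
    and rcd: "regular_cond_dist M MX MY X Y \<kappa>"
    and [measurable]: "f \<in> borel_measurable MX" "g \<in> borel_measurable MY"
    and int: "\<And>y. y \<in> space MY \<Longrightarrow> integrable (\<kappa> y) f"
    and mean: "AE y in distr M MY Y. cond_mean \<kappa> f y = 0"
  shows "l2_inner (distr M (MX \<Otimes>\<^sub>M MY) (\<lambda>\<omega>. (X \<omega>, Y \<omega>))) (f \<circ> fst) (g \<circ> snd) = 0"
proof -
  let ?P = "distr M (MX \<Otimes>\<^sub>M MY) (\<lambda>\<omega>. (X \<omega>, Y \<omega>))" and ?PY = "distr M MY Y"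
  let ?h = "\<lambda>z. f (fst z) * g (snd z)"
  have "(\<integral>\<^sup>+z. ennreal (?h z) \<partial>?P) = (\<integral>\<^sup>+y. \<integral>\<^sup>+x. ennreal (f x * g y) \<partial>\<kappa> y \<partial>?PY)"
    by (subst nn_integral_disintegration[OF X Y M rcd]) simp_all
  also have "\<dots> = (\<integral>\<^sup>+y. \<integral>\<^sup>+x. ennreal (- (f x * g y)) \<partial>\<kappa> y \<partial>?PY)"
  proof (rule nn_integral_cong_AE, use mean AE_space in eventually_elim)
    case (elim y)
    have "integrable (\<kappa> y) (\<lambda>x. f x * g y)"
      using int elim(2) by simp
    moreover have "(\<integral>x. f x * g y \<partial>\<kappa> y) = 0"
      using elim(1) by (simp add: cond_mean_def)
    ultimately show ?case
      by (elim integrableE) auto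
  qed
  also have "\<dots> = (\<integral>\<^sup>+z. ennreal (- ?h z) \<partial>?P)"
    by (subst nn_integral_disintegration[OF X Y M rcd]) simp_all
  finally have eq: "(\<integral>\<^sup>+z. ennreal (?h z) \<partial>?P) = (\<integral>\<^sup>+z. ennreal (- ?h z) \<partial>?P)" .
  have "(\<integral>z. ?h z \<partial>?P) = 0"
  proof (cases "integrable ?P ?h")
    case True
    then show ?thesis by (simp add: real_lebesgue_integral_def eq)
  next
    case False
    then show ?thesis by (rule not_integrable_integral_eq)
  qed
  then show ?thesis by (simp add: l2_inner_def)
qed

section \<open>The kernel of the averaged squared deviation\<close>

lemma covariance_eq_l2_inner:
  assumes [measurable]: "X \<in> measurable M MX"
    and f: "f \<in> L2_centered (distr M MX X)" and g: "g \<in> L2_centered (distr M MX X)"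
  shows "covariance M (\<lambda>\<omega>. f (X \<omega>)) (\<lambda>\<omega>. g (X \<omega>)) = l2_inner (distr M MX X) f g"
proof -
  have [measurable]: "f \<in> borel_measurable MX" "g \<in> borel_measurable MX"
    using L2_centeredD(1)[OF f] L2_centeredD(1)[OF g] by simp_all
  have "(\<integral>\<omega>. f (X \<omega>) \<partial>M) = 0" "(\<integral>\<omega>. g (X \<omega>) \<partial>M) = 0"
    using L2_centeredD(3)[OF f] L2_centeredD(3)[OF g] by (simp_all add: integral_distr)
  then show ?thesis
    by (simp add: covariance_def l2_inner_def integral_distr)
qed

lemma represents_form_op_minus:
  assumes "prob_space N" and T: "represents_form N T b" and U: "represents_form N U b'"
    and f: "f \<in> L2_centered N"
  shows "op_minus T U f \<in> L2_centered N"
    and "g \<in> L2_centered N \<Longrightarrow> l2_inner N g (op_minus T U f) = b g f - b' g f"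
proof -
  have TU: "T f \<in> L2_centered N" "U f \<in> L2_centered N"
    using T U f by (auto simp: represents_form_def bounded_op_def)
  then show "op_minus T U f \<in> L2_centered N"
    unfolding op_minus_def by (intro L2_centered_diff assms(1))
  assume g: "g \<in> L2_centered N"
  then have "l2_inner N g (T f) = b g f" "l2_inner N g (U f) = b' g f"
    using T U f by (simp_all add: represents_form_def)
  then show "l2_inner N g (op_minus T U f) = b g f - b' g f"
    using l2_inner_diff_left[OF TU g] by (simp add: op_minus_def l2_inner_commute[of N g])
qed

lemma cond_cov_commute: "cond_cov \<kappa> y f g = cond_cov \<kappa> y g f"
  by (simp add: cond_cov_def mult.commute)

lemma covariance_commute: "covariance M U W = covariance M W U"
  by (simp add: covariance_def mult.commute)

theorem theorem8:
  fixes M :: "'w measure" and MX :: "'a measure" and MY :: "'b measure"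
    and X :: "'w \<Rightarrow> 'a" and Y :: "'w \<Rightarrow> 'b"
    and PX :: "'a measure" and PY :: "'b measure" and PXY :: "('a \<times> 'b) measure"
    and \<kappa> :: "'b \<Rightarrow> 'a measure"
    and evX :: "'h::{real_inner, complete_space} \<Rightarrow> 'a \<Rightarrow> real"
    and evY :: "'k::{real_inner, complete_space} \<Rightarrow> 'b \<Rightarrow> real"
    and C1 C2 :: real
    and V :: "('a \<Rightarrow> real) \<Rightarrow> ('a \<Rightarrow> real)"
    and VXY :: "'b \<Rightarrow> ('a \<Rightarrow> real) \<Rightarrow> ('a \<Rightarrow> real)"
    and S :: "('a \<Rightarrow> real) \<Rightarrow> ('a \<Rightarrow> real)"
  assumes "prob_space M"
    and "X \<in> measurable M MX" and "Y \<in> measurable M MY"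
    and PX_eq: "PX = distr M MX X"
    and PY_eq: "PY = distr M MY Y"
    and PXY_eq: "PXY = distr M (MX \<Otimes>\<^sub>M MY) (\<lambda>\<omega>. (X \<omega>, Y \<omega>))"
    and "dominated PX" and "dominated PY" and "dominated PXY"
    and "regular_cond_dist M MX MY X Y \<kappa>"
    and "function_hilbert_space (space MX) evX"
    and "function_hilbert_space (space MY) evY"
    and A_X: "dense_mod_const PX (range evX) (L2_centered PX)"
    and A_Y: "dense_mod_const PY (range evY) (L2_centered PY)"
    and "C1 > 0" and "C2 > 0"
    and B_X: "\<And>h. prob_space.variance M (\<lambda>\<omega>. evX h (X \<omega>)) \<le> C1 * (norm h)\<^sup>2"
    and B_Y: "\<And>h. prob_space.variance M (\<lambda>\<omega>. evY h (Y \<omega>)) \<le> C2 * (norm h)\<^sup>2"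
    and V: "represents_form PX V (\<lambda>f g. covariance M (\<lambda>\<omega>. f (X \<omega>)) (\<lambda>\<omega>. g (X \<omega>)))"
    and VXY: "cond_variance_operator PX MY \<kappa> VXY"
    and "has_op_expectation PX PY (\<lambda>y. op_minus V (VXY y) \<circ> op_minus V (VXY y))"
    and S_eq: "S = op_expectation PY (\<lambda>y. op_minus V (VXY y) \<circ> op_minus V (VXY y))"
  shows "regression_class PX PY PXY \<subseteq> embed_fst (l2_closure PX (S ` L2_centered PX))"
proof
  interpret M: prob_space M by fact
  note X = \<open>X \<in> measurable M MX\<close> and Y = \<open>Y \<in> measurable M MY\<close>
  note rcd = \<open>regular_cond_dist M MX MY X Y \<kappa>\<close>
  have [measurable]: "X \<in> measurable M MX" "Y \<in> measurable M MY" by (fact X Y)+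
  have PX: "prob_space PX"
    unfolding PX_eq by (rule M.prob_space_distr[OF X])
  let ?D = "\<lambda>y. op_minus V (VXY y)"
  have S: "bounded_op PX S"
    and S_int: "\<And>f g. f \<in> L2_centered PX \<Longrightarrow> g \<in> L2_centered PX \<Longrightarrow>
      integrable PY (\<lambda>y. l2_inner PX g (?D y (?D y f)))"
    and S_inner: "\<And>f g. f \<in> L2_centered PX \<Longrightarrow> g \<in> L2_centered PX \<Longrightarrow>
      l2_inner PX g (S f) = (\<integral>y. l2_inner PX g (?D y (?D y f)) \<partial>PY)"
    using \<open>has_op_expectation PX PY _\<close> by (simp_all add: has_op_expectation_def S_eq)
  have S_closed: "S f \<in> L2_centered PX" if "f \<in> L2_centered PX" for f
    using S that by (simp add: bounded_op_def)
  have S_add: "AE x in PX. S (\<lambda>x. f x + g x) x = S f x + S g x"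
    if "f \<in> L2_centered PX" "g \<in> L2_centered PX" for f g
    using S that by (simp add: bounded_op_def)
  have S_scale: "AE x in PX. S (\<lambda>x. c * f x) x = c * S f x"
    if "f \<in> L2_centered PX" for c f
    using S that by (simp add: bounded_op_def)
  have VXY_form: "represents_form PX (VXY y) (cond_cov \<kappa> y)" if "y \<in> space MY" for y
    using VXY that by (simp add: cond_variance_operator_def)
  note D = represents_form_op_minus[OF PX V VXY_form]
  have kernel: "l2_inner PXY (k \<circ> fst) (g \<circ> snd) = 0"
    if k: "k \<in> L2_centered PX" and k0: "l2_inner PX k (S k) = 0"
      and g: "g \<in> L2_centered PY" for k g
  proof -
    \<comment> \<open>\<open>?D y\<close> is self-adjoint because the form it represents is symmetric.\<close>
    have square: "l2_inner PX k (?D y (?D y k)) = l2_inner PX (?D y k) (?D y k)"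
      if y: "y \<in> space MY" for y
      using D(2)[OF y D(1)[OF y k] k] D(2)[OF y k D(1)[OF y k]]
      by (simp add: cond_cov_commute[of _ _ k] covariance_commute[of _ "\<lambda>\<omega>. k (X \<omega>)"])
    have "(\<integral>y. l2_inner PX k (?D y (?D y k)) \<partial>PY) = 0"
      using S_inner[OF k k] k0 by simp
    then have "AE y in PY. l2_inner PX k (?D y (?D y k)) = 0"
      by (subst (asm) integral_nonneg_eq_0_iff_AE[OF S_int[OF k k]])
        (auto simp: PY_eq square)
    then have var: "AE y in PY. cond_cov \<kappa> y k k = (\<integral>x. (k x)\<^sup>2 \<partial>PX)"
      using AE_space
    proof eventually_elim
      case (elim y)
      then have y: "y \<in> space MY" by (simp add: PY_eq)
      have "(l2_inner PX k (?D y k))\<^sup>2 \<le> l2_inner PX k k * 0"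
        using l2_inner_Cauchy_Schwarz[OF PX k D(1)[OF y k]] elim(1) square[OF y] by simp
      then have "l2_inner PX k (?D y k) = 0" by simp
      then show ?case
        using D(2)[OF y k k] covariance_eq_l2_inner[OF X k[unfolded PX_eq] k[unfolded PX_eq]]
        by (simp add: PX_eq l2_inner_def power2_eq_square)
    qed
    have km: "k \<in> borel_measurable MX" and gm: "g \<in> borel_measurable MY"
      using L2_centeredD(1)[OF k] L2_centeredD(1)[OF g] by (simp_all add: PX_eq PY_eq)
    have int: "integrable (\<kappa> y) k" "integrable (\<kappa> y) (\<lambda>x. (k x)\<^sup>2)" if "y \<in> space MY" for y
      using VXY that k by (simp_all add: cond_variance_operator_def)
    have "AE y in distr M MY Y. cond_mean \<kappa> k y = 0"
      using var L2_centeredD(2)[OF k] unfolding PX_eq PY_eq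
      by (intro cond_mean_eq_0_if_cond_variance_eq_second_moment[OF \<open>prob_space M\<close> X Y rcd km _ int(2)])
    then show ?thesis
      unfolding PXY_eq
      by (intro orthogonal_if_cond_mean_eq_0[OF \<open>prob_space M\<close> X Y rcd km gm] int(1))
  qed
  fix \<phi> assume "\<phi> \<in> regression_class PX PY PXY"
  then obtain h where h: "h \<in> L2_centered PX" and \<phi>: "\<phi> = h \<circ> fst"
    and orth: "\<And>k. k \<in> L2_centered PX \<Longrightarrow>
      (\<And>g. g \<in> L2_centered PY \<Longrightarrow> l2_inner PXY (k \<circ> fst) (g \<circ> snd) = 0) \<Longrightarrow>
      l2_inner PXY (h \<circ> fst) (k \<circ> fst) = 0"
    by (auto simp: regression_class_def ortho_diff_def embed_fst_def embed_snd_def)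
  have "h \<in> l2_closure PX (S ` L2_centered PX)"
  proof (rule in_l2_closure_if_orthogonal[OF PX _ _ _ h])
    show "S ` L2_centered PX \<subseteq> L2_centered PX" using S_closed by blast
    show "S ` L2_centered PX \<noteq> {}" using h by blast
  next
    fix a b s t assume "a \<in> S ` L2_centered PX" "b \<in> S ` L2_centered PX"
    then obtain f g where f: "f \<in> L2_centered PX" "a = S f"
      and g: "g \<in> L2_centered PX" "b = S g" by blast
    have scale: "(\<lambda>x. r * u x) \<in> L2_centered PX" if "u \<in> L2_centered PX" for r u
      using L2_centered_combination[OF PX that that, of r 0] by simp
    have "AE x in PX. S (\<lambda>x. s * f x + t * g x) x = S (\<lambda>x. s * f x) x + S (\<lambda>x. t * g x) x"
      by (rule S_add[OF scale[OF f(1)] scale[OF g(1)]])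
    moreover have "AE x in PX. S (\<lambda>x. s * f x) x = s * S f x"
      "AE x in PX. S (\<lambda>x. t * g x) x = t * S g x"
      by (rule S_scale[OF f(1)], rule S_scale[OF g(1)])
    ultimately have "AE x in PX. S (\<lambda>x. s * f x + t * g x) x = s * a x + t * b x"
      by eventually_elim (simp add: f(2) g(2))
    then show "\<exists>c\<in>S ` L2_centered PX. AE x in PX. c x = s * a x + t * b x"
      using L2_centered_combination[OF PX f(1) g(1), of s t] by blast
  next
    fix k assume k: "k \<in> L2_centered PX"
      and perp: "\<And>a. a \<in> S ` L2_centered PX \<Longrightarrow> l2_inner PX k a = 0"
    have "l2_inner PX k (S k) = 0" using perp k by blast
    then have "l2_inner PXY (h \<circ> fst) (k \<circ> fst) = 0"
      using orth[OF k kernel[OF k]] by blast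
    moreover have "l2_inner PXY (h \<circ> fst) (k \<circ> fst) = l2_inner PX h k"
    proof -
      have [measurable]: "h \<in> borel_measurable MX" "k \<in> borel_measurable MX"
        using L2_centeredD(1)[OF h] L2_centeredD(1)[OF k] by (simp_all add: PX_eq)
      show ?thesis by (simp add: l2_inner_def PX_eq PXY_eq integral_distr)
    qed
    ultimately show "l2_inner PX h k = 0" by simp
  qed
  then show "\<phi> \<in> embed_fst (l2_closure PX (S ` L2_centered PX))"
    by (auto simp: \<phi> embed_fst_def)
qed

end
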